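(* The reduction relation $\rightarrow_{\beta\pi\mu}$ of $\lambda\mathbf{J}^{\mathbf{m}}$ is confluent.
   Context: $\lambda\mathbf{J}^{\mathbf m}$: terms $t,u,v::=x\mid\lambda x.t\mid t(u,l)$; co-terms $l::=u::l\mid(x)v$ ($(x)$ binds $x$ in $v$; capture-avoiding substitution). A value $V$ is a variable or a $\lambda$-abstraction. Generalised arguments $R,S$ are pairs $(u,l)$; $tRS$ means $(tR)S$. Append: $(u::l)@S=u::(l@S)$, $((x)V)@S=(x)(VS)$ for $V$ a value, $((x)t(u,l))@S=(x)t(u,l@S)$, and $(u,l)@S=(u,l@S)$. The reduction is the closure under all constructors of: $(\beta_1)\ (\lambda x.t)(u,(y)v)\rightarrow[[u/x]t/y]v$; $(\beta_2)\ (\lambda x.t)(u,v::l)\rightarrow([u/x]t)(v,l)$; $(\pi)\ tRS\rightarrow t(R@S)$; $(\mu)\ (x)x(u,l)\rightarrow u::l$ if $x$ is free in neither $u$ nor $l$; $\beta=\beta_1\cup\beta_2$. Confluence: whenever $t\rightarrow^*t_1$ and $t\rightarrow^*t_2$ there is $t_3$ with $t_i\rightarrow^*t_3$. *)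

theory Defs
  imports "HOL-Library.Confluence"
begin

text \<open>
  Expressions modulo alpha-equivalence are represented with de Bruijn indices.
  \<open>App t u l\<close> is \<open>t(u,l)\<close>, \<open>CoCons u l\<close> is \<open>u::l\<close>, and \<open>Sel v\<close> is \<open>(x)v\<close>, where index 0
  of \<open>v\<close> stands for \<open>x\<close>. A generalised argument is passed as its two components.
\<close>

datatype trm =
    Var nat
  | Lam trm
  | App trm trm cotrm
and cotrm =
    CoCons trm cotrm
  | Sel trm

primrec lift :: "nat \<Rightarrow> trm \<Rightarrow> trm" and lift_co :: "nat \<Rightarrow> cotrm \<Rightarrow> cotrm" where
  "lift k (Var i) = Var (if i < k then i else Suc i)"
| "lift k (Lam t) = Lam (lift (Suc k) t)"
| "lift k (App t u l) = App (lift k t) (lift k u) (lift_co k l)"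
| "lift_co k (CoCons u l) = CoCons (lift k u) (lift_co k l)"
| "lift_co k (Sel v) = Sel (lift (Suc k) v)"

text \<open>
  \<open>subst s k t\<close> is \<open>[s/k]t\<close>; the indices of \<open>t\<close> above \<open>k\<close> are lowered by one because
  the binder of \<open>k\<close> is removed.
\<close>

primrec subst :: "trm \<Rightarrow> nat \<Rightarrow> trm \<Rightarrow> trm" and subst_co :: "trm \<Rightarrow> nat \<Rightarrow> cotrm \<Rightarrow> cotrm" where
  "subst s k (Var i) = (if i < k then Var i else if i = k then s else Var (i - 1))"
| "subst s k (Lam t) = Lam (subst (lift 0 s) (Suc k) t)"
| "subst s k (App t u l) = App (subst s k t) (subst s k u) (subst_co s k l)"
| "subst_co s k (CoCons u l) = CoCons (subst s k u) (subst_co s k l)"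
| "subst_co s k (Sel v) = Sel (subst (lift 0 s) (Suc k) v)"

text \<open>
  \<open>co_append l u' l'\<close> is \<open>l @ (u',l')\<close>. The second and third equations are the clause for
  \<open>(x)V\<close> with \<open>V\<close> a value. When the generalised argument moves under the binder \<open>(x)\<close>,
  it is lifted so that it is not captured.
\<close>

fun co_append :: "cotrm \<Rightarrow> trm \<Rightarrow> cotrm \<Rightarrow> cotrm" where
  "co_append (CoCons u l) u' l' = CoCons u (co_append l u' l')"
| "co_append (Sel (Var i)) u' l' = Sel (App (Var i) (lift 0 u') (lift_co 0 l'))"
| "co_append (Sel (Lam t)) u' l' = Sel (App (Lam t) (lift 0 u') (lift_co 0 l'))"
| "co_append (Sel (App t u l)) u' l' = Sel (App t u (co_append l (lift 0 u') (lift_co 0 l')))"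

inductive root_beta1 :: "trm \<Rightarrow> trm \<Rightarrow> bool" where
  "root_beta1 (App (Lam t) u (Sel v)) (subst (subst u 0 t) 0 v)"

inductive root_beta2 :: "trm \<Rightarrow> trm \<Rightarrow> bool" where
  "root_beta2 (App (Lam t) u (CoCons v l)) (App (subst u 0 t) v l)"

definition root_beta :: "trm \<Rightarrow> trm \<Rightarrow> bool" where
  "root_beta t t' \<longleftrightarrow> root_beta1 t t' \<or> root_beta2 t t'"

text \<open>
  The contractum of \<open>\<pi>\<close> is \<open>t(R @ S)\<close> with \<open>(u,l) @ S = (u, l @ S)\<close>.
\<close>

inductive root_pi :: "trm \<Rightarrow> trm \<Rightarrow> bool" where
  "root_pi (App (App t u l) u' l') (App t u (co_append l u' l'))"

text \<open>
  The side condition of \<open>\<mu>\<close> is built into the redex: the expressions under the binder in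
  which index 0 is not free are exactly those of the form \<open>lift 0 u\<close> or \<open>lift_co 0 l\<close>, and
  \<open>u\<close>, \<open>l\<close> are what they become outside the binder.
\<close>

inductive root_mu :: "cotrm \<Rightarrow> cotrm \<Rightarrow> bool" where
  "root_mu (Sel (App (Var 0) (lift 0 u) (lift_co 0 l))) (CoCons u l)"

text \<open>
  Closure under all constructors of a relation \<open>P\<close> on terms together with a relation \<open>Q\<close> on
  co-terms.
\<close>

inductive compat :: "(trm \<Rightarrow> trm \<Rightarrow> bool) \<Rightarrow> (cotrm \<Rightarrow> cotrm \<Rightarrow> bool) \<Rightarrow> trm \<Rightarrow> trm \<Rightarrow> bool"
  and compat_co :: "(trm \<Rightarrow> trm \<Rightarrow> bool) \<Rightarrow> (cotrm \<Rightarrow> cotrm \<Rightarrow> bool) \<Rightarrow> cotrm \<Rightarrow> cotrm \<Rightarrow> bool"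
  for P :: "trm \<Rightarrow> trm \<Rightarrow> bool" and Q :: "cotrm \<Rightarrow> cotrm \<Rightarrow> bool" where
  base: "P t t' \<Longrightarrow> compat P Q t t'"
| lam: "compat P Q t t' \<Longrightarrow> compat P Q (Lam t) (Lam t')"
| app_fun: "compat P Q t t' \<Longrightarrow> compat P Q (App t u l) (App t' u l)"
| app_arg: "compat P Q u u' \<Longrightarrow> compat P Q (App t u l) (App t u' l)"
| app_co: "compat_co P Q l l' \<Longrightarrow> compat P Q (App t u l) (App t u l')"
| base_co: "Q l l' \<Longrightarrow> compat_co P Q l l'"
| cons_head: "compat P Q u u' \<Longrightarrow> compat_co P Q (CoCons u l) (CoCons u' l)"
| cons_tail: "compat_co P Q l l' \<Longrightarrow> compat_co P Q (CoCons u l) (CoCons u l')"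
| sel: "compat P Q v v' \<Longrightarrow> compat_co P Q (Sel v) (Sel v')"

definition red :: "trm \<Rightarrow> trm \<Rightarrow> bool" where
  "red = compat (\<lambda>t t'. root_beta t t' \<or> root_pi t t') root_mu"

definition red_co :: "cotrm \<Rightarrow> cotrm \<Rightarrow> bool" where
  "red_co = compat_co (\<lambda>t t'. root_beta t t' \<or> root_pi t t') root_mu"

end

theory Submission
  imports Defs
begin

text \<open>
  Every expression has a \<open>\<pi>\<mu>\<close>-normal form, computed structurally by \<open>nf\<close>. The \<open>\<beta>\<close>-rules alone
  are orthogonal, so parallel \<open>\<beta>\<close>-reduction has the diamond property. It is moreover simulated on
  normal forms by one parallel \<open>\<beta>\<close>-step followed by normalisation, and this composite step
  therefore inherits the diamond property. Since \<open>nf\<close> maps every \<open>\<beta>\<pi>\<mu>\<close>-step to a composite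
  step, and composite steps are \<open>\<beta>\<pi>\<mu>\<close>-reductions, confluence follows.
\<close>

section \<open>Lifting and substitution\<close>

lemma lift_lift:
  "i \<le> k \<Longrightarrow> lift (Suc k) (lift i t) = lift i (lift k t)"
  "i \<le> k \<Longrightarrow> lift_co (Suc k) (lift_co i l) = lift_co i (lift_co k l)"
  by (induction t and l arbitrary: i k and i k rule: trm.induct cotrm.induct) auto

lemma subst_lift [simp]:
  "subst s k (lift k t) = t"
  "subst_co s k (lift_co k l) = l"
  by (induction t and l arbitrary: s k and s k rule: trm.induct cotrm.induct) auto

lemma lift_inject [simp]:
  "lift k t = lift k t' \<longleftrightarrow> t = t'"
  "lift_co k l = lift_co k l' \<longleftrightarrow> l = l'"
  by (metis subst_lift)+

lemma lift_subst_ge: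
  "i \<le> k \<Longrightarrow> lift k (subst s i t) = subst (lift k s) i (lift (Suc k) t)"
  "i \<le> k \<Longrightarrow> lift_co k (subst_co s i l) = subst_co (lift k s) i (lift_co (Suc k) l)"
  by (induction t and l arbitrary: s i k and s i k rule: trm.induct cotrm.induct)
    (auto simp: lift_lift)

lemma lift_subst_le:
  "k \<le> i \<Longrightarrow> lift k (subst s i t) = subst (lift k s) (Suc i) (lift k t)"
  "k \<le> i \<Longrightarrow> lift_co k (subst_co s i l) = subst_co (lift k s) (Suc i) (lift_co k l)"
  by (induction t and l arbitrary: s i k and s i k rule: trm.induct cotrm.induct)
    (auto simp: lift_lift)

text \<open>The substitution lemma in index form. On the right the binder \<open>i\<close> is still
  in place while \<open>s\<close> is substituted, hence the target \<open>Suc j\<close> and the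
  lifted \<open>lift i s\<close>.\<close>

lemma subst_subst:
  "i \<le> j \<Longrightarrow> subst s j (subst u i t) = subst (subst s j u) i (subst (lift i s) (Suc j) t)"
  "i \<le> j \<Longrightarrow>
    subst_co s j (subst_co u i l) = subst_co (subst s j u) i (subst_co (lift i s) (Suc j) l)"
  by (induction t and l arbitrary: s u i j and s u i j rule: trm.induct cotrm.induct)
    (auto simp: lift_lift lift_subst_le)

text \<open>Lifting from \<open>Suc k\<close> on leaves index 0 alone, so it cannot remove an
  occurrence of it. This is what keeps lifting from creating a \<mu>-redex in
  \<open>lift_msel\<close>.\<close>

lemma lift_Suc_eq_lift_0D:
  "lift (Suc k) t = lift 0 t' \<Longrightarrow> \<exists>t0. t = lift 0 t0"
  "lift_co (Suc k) l = lift_co 0 l' \<Longrightarrow> \<exists>l0. l = lift_co 0 l0"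
proof -
  assume "lift (Suc k) t = lift 0 t'"
  \<comment> \<open>Substituting anything for index 0 undoes \<open>lift 0\<close>;
    \<open>Var 0\<close> is a placeholder.\<close>
  then have "t' = lift k (subst (Var 0) 0 t)"
    by (metis subst_lift(1) lift_subst_ge(1) le0)
  then show "\<exists>t0. t = lift 0 t0"
    by (metis \<open>lift (Suc k) t = lift 0 t'\<close> le0 lift_inject(1) lift_lift(1))
next
  assume "lift_co (Suc k) l = lift_co 0 l'"
  then have "l' = lift_co k (subst_co (Var 0) 0 l)"
    by (metis subst_lift(2) lift_subst_ge(2) le0)
  then show "\<exists>l0. l = lift_co 0 l0"
    by (metis \<open>lift_co (Suc k) l = lift_co 0 l'\<close> le0 lift_inject(2) lift_lift(2))
qed

lemma eq_lift_iff:
  "Lam s = lift k t \<longleftrightarrow> (\<exists>t0. t = Lam t0 \<and> s = lift (Suc k) t0)"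
  "App s u l = lift k t \<longleftrightarrow>
    (\<exists>t0 u0 l0. t = App t0 u0 l0 \<and> s = lift k t0 \<and> u = lift k u0 \<and> l = lift_co k l0)"
  "CoCons u l = lift_co k m \<longleftrightarrow> (\<exists>u0 l0. m = CoCons u0 l0 \<and> u = lift k u0 \<and> l = lift_co k l0)"
  "Sel v = lift_co k m \<longleftrightarrow> (\<exists>v0. m = Sel v0 \<and> v = lift (Suc k) v0)"
  by ((cases t; auto), (cases t; auto), (cases m; auto), (cases m; auto))


section \<open>Normal forms for \<open>\<pi>\<close> and \<open>\<mu>\<close>\<close>

definition mu_redex :: "trm \<Rightarrow> bool" where
  "mu_redex v \<longleftrightarrow> (\<exists>u l. v = App (Var 0) (lift 0 u) (lift_co 0 l))"

text \<open>Acts as the constructor \<open>Sel\<close>, but contracts a \<mu>-redex at the root.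
  Index 0 is then absent from \<open>u\<close> and \<open>l\<close>, so substituting
  \<open>Var 0\<close> for it only inverts \<open>lift 0\<close>.\<close>

definition msel :: "trm \<Rightarrow> cotrm" where
  "msel v = (if mu_redex v
    then (case v of App t u l \<Rightarrow> CoCons (subst (Var 0) 0 u) (subst_co (Var 0) 0 l))
    else Sel v)"

lemma msel_redex [simp]: "msel (App (Var 0) (lift 0 u) (lift_co 0 l)) = CoCons u l"
  by (auto simp: msel_def mu_redex_def)

lemma msel_cases:
  obtains u l where "v = App (Var 0) (lift 0 u) (lift_co 0 l)" "msel v = CoCons u l"
  | "\<not> mu_redex v" "msel v = Sel v"
  by (metis msel_def msel_redex mu_redex_def)

text \<open>Application and append that contract the \<pi>- and \<mu>-redexes arising when normal
  pieces are joined. Going through \<open>papp\<close> under \<open>Sel\<close> merges the value and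
  application clauses of \<open>co_append\<close>.\<close>

primrec papp :: "trm \<Rightarrow> trm \<Rightarrow> cotrm \<Rightarrow> trm"
  and papp_co :: "cotrm \<Rightarrow> trm \<Rightarrow> cotrm \<Rightarrow> cotrm" where
  "papp (Var i) u' l' = App (Var i) u' l'"
| "papp (Lam t) u' l' = App (Lam t) u' l'"
| "papp (App t u l) u' l' = App t u (papp_co l u' l')"
| "papp_co (CoCons u l) u' l' = CoCons u (papp_co l u' l')"
| "papp_co (Sel v) u' l' = msel (papp v (lift 0 u') (lift_co 0 l'))"

primrec nf :: "trm \<Rightarrow> trm" and nf_co :: "cotrm \<Rightarrow> cotrm" where
  "nf (Var i) = Var i"
| "nf (Lam t) = Lam (nf t)"
| "nf (App t u l) = papp (nf t) (nf u) (nf_co l)"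
| "nf_co (CoCons u l) = CoCons (nf u) (nf_co l)"
| "nf_co (Sel v) = msel (nf v)"

lemma lift_msel: "lift_co k (msel v) = msel (lift (Suc k) v)"
proof (cases v rule: msel_cases)
  case (1 u l)
  then show ?thesis by (simp add: lift_lift)
next
  case 2
  \<comment> \<open>The head \<open>Var 0\<close> and the absence of index 0 from the arguments both
    carry back from the lifted term to \<open>v\<close>.\<close>
  have "\<not> mu_redex (lift (Suc k) v)"
  proof
    assume "mu_redex (lift (Suc k) v)"
    then obtain u l where "App (Var 0) (lift 0 u) (lift_co 0 l) = lift (Suc k) v"
      by (metis mu_redex_def)
    then obtain t0 u0 l0 where v: "v = App t0 u0 l0" "Var 0 = lift (Suc k) t0"
      "lift 0 u = lift (Suc k) u0" "lift_co 0 l = lift_co (Suc k) l0"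
      by (auto simp: eq_lift_iff)
    have "t0 = Var 0"
      using v(2) by (cases t0) (auto split: if_splits)
    moreover obtain u1 l1 where "u0 = lift 0 u1" "l0 = lift_co 0 l1"
      using v(3,4)[symmetric] by (blast dest: lift_Suc_eq_lift_0D)
    ultimately have "mu_redex v"
      using v(1) by (auto simp: mu_redex_def)
    with 2 show False by simp
  qed
  with 2 show ?thesis by (simp add: msel_def)
qed

lemma lift_papp:
  "lift k (papp t u' l') = papp (lift k t) (lift k u') (lift_co k l')"
  "lift_co k (papp_co l u' l') = papp_co (lift_co k l) (lift k u') (lift_co k l')"
  by (induction t and l arbitrary: k u' l' and k u' l' rule: trm.induct cotrm.induct)
    (auto simp: lift_msel lift_lift)

lemma nf_lift:
  "nf (lift k t) = lift k (nf t)"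
  "nf_co (lift_co k l) = lift_co k (nf_co l)"
  by (induction t and l arbitrary: k and k rule: trm.induct cotrm.induct)
    (auto simp: lift_msel lift_papp)

text \<open>Appending under the binder keeps the head \<open>Var 0\<close> and adds only lifted
  material, so a \<mu>-redex stays one and may be contracted before or after.\<close>

lemma papp_co_msel: "papp_co (msel v) u l = msel (papp v (lift 0 u) (lift_co 0 l))"
proof (cases v rule: msel_cases)
  case (1 u0 l0)
  have "msel (papp v (lift 0 u) (lift_co 0 l))
      = msel (App (Var 0) (lift 0 u0) (lift_co 0 (papp_co l0 u l)))"
    using 1 by (simp add: lift_papp)
  then show ?thesis using 1 by simp
qed simp

text \<open>Associativity of append is what joins overlapping \<pi>-redexes;
  \<open>papp_co_msel\<close> absorbs the \<mu>-contractions on the way.\<close>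

lemma papp_assoc:
  "papp (papp t u1 l1) u2 l2 = papp t u1 (papp_co l1 u2 l2)"
  "papp_co (papp_co l u1 l1) u2 l2 = papp_co l u1 (papp_co l1 u2 l2)"
  by (induction t and l arbitrary: u1 l1 u2 l2 and u1 l1 u2 l2 rule: trm.induct cotrm.induct)
    (auto simp: papp_co_msel lift_papp)

section \<open>Compatibility of normalisation with substitution\<close>

text \<open>Substitution at \<open>Suc k\<close> touches neither the bound head \<open>Var 0\<close>
  nor the vacuity of index 0, so a \<mu>-redex contracted early would still be contracted
  afterwards.\<close>

lemma nf_co_msel_subst:
  "nf_co (subst_co s k (msel v)) = msel (nf (subst (lift 0 s) (Suc k) v))"
proof (cases v rule: msel_cases)
  case (1 u l)
  then show ?thesis by (simp flip: lift_subst_le add: nf_lift)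
qed simp

text \<open>Replacing a head variable may create \<pi>-redexes; the outer \<open>nf\<close> removes
  them, and \<open>papp_assoc\<close> shows that the order of removal is immaterial.\<close>

lemma nf_subst_papp:
  "nf (subst s k (papp t u' l')) = papp (nf (subst s k t)) (nf (subst s k u')) (nf_co (subst_co s k l'))"
  "nf_co (subst_co s k (papp_co l u' l'))
    = papp_co (nf_co (subst_co s k l)) (nf (subst s k u')) (nf_co (subst_co s k l'))"
  by (induction t and l arbitrary: s k u' l' and s k u' l' rule: trm.induct cotrm.induct)
    (auto simp: papp_assoc nf_co_msel_subst papp_co_msel nf_lift simp flip: lift_subst_le)

lemma nf_subst_nf:
  "nf (subst s k (nf t)) = nf (subst s k t)"
  "nf_co (subst_co s k (nf_co l)) = nf_co (subst_co s k l)"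
  by (induction t and l arbitrary: s k and s k rule: trm.induct cotrm.induct)
    (auto simp: nf_subst_papp nf_co_msel_subst)

text \<open>Idempotence is the case of a vacuous substitution.\<close>

lemma nf_nf [simp]:
  "nf (nf t) = nf t"
  "nf_co (nf_co l) = nf_co l"
  by (metis nf_lift subst_lift nf_subst_nf)+

lemma nf_subst_nf_left:
  "nf (subst (nf s) k t) = nf (subst s k t)"
  "nf_co (subst_co (nf s) k l) = nf_co (subst_co s k l)"
  by (induction t and l arbitrary: s k and s k rule: trm.induct cotrm.induct)
    (auto simp flip: nf_lift)

lemma nf_subst_cong:
  "nf s = nf s' \<Longrightarrow> nf t = nf t' \<Longrightarrow> nf (subst s k t) = nf (subst s' k t')"
  by (metis nf_subst_nf(1) nf_subst_nf_left(1))

text \<open>With \<open>papp_assoc\<close>, this makes both sides of a \<pi>-step have the same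
  normal form.\<close>

lemma nf_co_append: "nf_co (co_append l u' l') = papp_co (nf_co l) (nf u') (nf_co l')"
  by (induction l u' l' rule: co_append.induct)
    (auto simp: nf_lift papp_assoc papp_co_msel)


section \<open>Parallel \<open>\<beta>\<close>-reduction\<close>

text \<open>Only \<beta> is included, since \<pi> and \<mu> overlap with it. In \<open>beta2\<close>
  the new outer application is not contracted in the same step, even if its head has become an
  abstraction.\<close>

inductive par :: "trm \<Rightarrow> trm \<Rightarrow> bool" and par_co :: "cotrm \<Rightarrow> cotrm \<Rightarrow> bool" where
  var: "par (Var i) (Var i)"
| lam: "par t t' \<Longrightarrow> par (Lam t) (Lam t')"
| app: "par t t' \<Longrightarrow> par u u' \<Longrightarrow> par_co l l' \<Longrightarrow> par (App t u l) (App t' u' l')"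
| beta1: "par t t' \<Longrightarrow> par u u' \<Longrightarrow> par v v' \<Longrightarrow>
    par (App (Lam t) u (Sel v)) (subst (subst u' 0 t') 0 v')"
| beta2: "par t t' \<Longrightarrow> par u u' \<Longrightarrow> par v v' \<Longrightarrow> par_co l l' \<Longrightarrow>
    par (App (Lam t) u (CoCons v l)) (App (subst u' 0 t') v' l')"
| cons: "par u u' \<Longrightarrow> par_co l l' \<Longrightarrow> par_co (CoCons u l) (CoCons u' l')"
| sel: "par v v' \<Longrightarrow> par_co (Sel v) (Sel v')"

inductive_cases par_VarE [elim!]: "par (Var i) t'"
inductive_cases par_LamE [elim!]: "par (Lam t) t'"
inductive_cases par_AppE: "par (App t u l) t'"
inductive_cases par_ConsE [elim!]: "par_co (CoCons u l) l'"
inductive_cases par_SelE [elim!]: "par_co (Sel v) l'"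

lemma par_App_Var:
  assumes "par (App (Var i) u l) t'"
  obtains u' l' where "t' = App (Var i) u' l'" "par u u'" "par_co l l'"
  using assms by (auto elim: par_AppE)

lemma par_refl [simp]: "par t t" "par_co l l"
  by (induction t and l rule: trm.induct cotrm.induct) (auto intro: par_par_co.intros)

lemma par_lift:
  "par t t' \<Longrightarrow> par (lift k t) (lift k t')"
  "par_co l l' \<Longrightarrow> par_co (lift_co k l) (lift_co k l')"
  by (induction arbitrary: k and k rule: par_par_co.inducts)
    (auto simp: lift_subst_ge intro: par_par_co.intros)

lemma par_subst:
  "par t t' \<Longrightarrow> par s s' \<Longrightarrow> par (subst s k t) (subst s' k t')"
  "par_co l l' \<Longrightarrow> par s s' \<Longrightarrow> par_co (subst_co s k l) (subst_co s' k l')"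
  by (induction arbitrary: s s' k and s s' k rule: par_par_co.inducts)
    (auto simp: subst_subst par_lift intro: par_par_co.intros)

text \<open>Reduction creates no free indices, so the side condition of \<mu> survives parallel
  steps.\<close>

lemma par_liftD:
  "par t t' \<Longrightarrow> t = lift k t0 \<Longrightarrow> \<exists>t0'. t' = lift k t0' \<and> par t0 t0'"
  "par_co l l' \<Longrightarrow> l = lift_co k l0 \<Longrightarrow> \<exists>l0'. l' = lift_co k l0' \<and> par_co l0 l0'"
proof (induction arbitrary: k t0 and k l0 rule: par_par_co.inducts)
  case (var i)
  then show ?case by (metis par_refl(1))
next
  case (lam t t')
  then obtain t1 where t0: "t0 = Lam t1" "t = lift (Suc k) t1"
    by (auto simp: eq_lift_iff)
  from lam.IH[OF t0(2)] obtain t2 where "t' = lift (Suc k) t2" "par t1 t2" by blast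
  then show ?case unfolding t0 by (intro exI[of _ "Lam t2"]) (auto intro: par_par_co.lam)
next
  case (app t t' u u' l l')
  then obtain t1 u1 l1 where t0: "t0 = App t1 u1 l1" "t = lift k t1" "u = lift k u1" "l = lift_co k l1"
    by (auto simp: eq_lift_iff)
  from app.IH(1)[OF t0(2)] app.IH(2)[OF t0(3)] app.IH(3)[OF t0(4)] obtain t2 u2 l2 where
    "t' = lift k t2" "u' = lift k u2" "l' = lift_co k l2" "par t1 t2" "par u1 u2" "par_co l1 l2"
    by blast
  then show ?case unfolding t0 by (intro exI[of _ "App t2 u2 l2"]) (auto intro: par_par_co.app)
next
  case (beta1 t t' u u' v v')
  then obtain t1 u1 v1 where t0: "t0 = App (Lam t1) u1 (Sel v1)"
    "t = lift (Suc k) t1" "u = lift k u1" "v = lift (Suc k) v1"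
    by (auto simp: eq_lift_iff)
  from beta1.IH(1)[OF t0(2)] beta1.IH(2)[OF t0(3)] beta1.IH(3)[OF t0(4)] obtain t2 u2 v2 where
    "t' = lift (Suc k) t2" "u' = lift k u2" "v' = lift (Suc k) v2" "par t1 t2" "par u1 u2" "par v1 v2"
    by blast
  then show ?case unfolding t0
    by (intro exI[of _ "subst (subst u2 0 t2) 0 v2"]) (auto simp: lift_subst_ge intro: par_par_co.beta1)
next
  case (beta2 t t' u u' v v' l l')
  then obtain t1 u1 v1 l1 where t0: "t0 = App (Lam t1) u1 (CoCons v1 l1)"
    "t = lift (Suc k) t1" "u = lift k u1" "v = lift k v1" "l = lift_co k l1"
    by (auto simp: eq_lift_iff)
  from beta2.IH(1)[OF t0(2)] beta2.IH(2)[OF t0(3)] beta2.IH(3)[OF t0(4)] beta2.IH(4)[OF t0(5)]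
  obtain t2 u2 v2 l2 where
    "t' = lift (Suc k) t2" "u' = lift k u2" "v' = lift k v2" "l' = lift_co k l2"
    "par t1 t2" "par u1 u2" "par v1 v2" "par_co l1 l2"
    by blast
  then show ?case unfolding t0
    by (intro exI[of _ "App (subst u2 0 t2) v2 l2"]) (auto simp: lift_subst_ge intro: par_par_co.beta2)
next
  case (cons u u' l l')
  then obtain u1 l1 where l0: "l0 = CoCons u1 l1" "u = lift k u1" "l = lift_co k l1"
    by (auto simp: eq_lift_iff)
  from cons.IH(1)[OF l0(2)] cons.IH(2)[OF l0(3)] obtain u2 l2 where
    "u' = lift k u2" "l' = lift_co k l2" "par u1 u2" "par_co l1 l2"
    by blast
  then show ?case unfolding l0 by (intro exI[of _ "CoCons u2 l2"]) (auto intro: par_par_co.cons)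
next
  case (sel v v')
  then obtain v1 where l0: "l0 = Sel v1" "v = lift (Suc k) v1"
    by (auto simp: eq_lift_iff)
  from sel.IH[OF l0(2)] obtain v2 where "v' = lift (Suc k) v2" "par v1 v2" by blast
  then show ?case unfolding l0 by (intro exI[of _ "Sel v2"]) (auto intro: par_par_co.sel)
qed

section \<open>Complete developments\<close>

fun dev :: "trm \<Rightarrow> trm" and dev_co :: "cotrm \<Rightarrow> cotrm" where
  "dev (Var i) = Var i"
| "dev (Lam t) = Lam (dev t)"
| "dev (App (Lam t) u (Sel v)) = subst (subst (dev u) 0 (dev t)) 0 (dev v)"
| "dev (App (Lam t) u (CoCons v l)) = App (subst (dev u) 0 (dev t)) (dev v) (dev_co l)"
| "dev (App t u l) = App (dev t) (dev u) (dev_co l)"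
| "dev_co (CoCons u l) = CoCons (dev u) (dev_co l)"
| "dev_co (Sel v) = Sel (dev v)"

text \<open>Takahashi's triangle property: \<open>dev t\<close> contracts all \<beta>-redexes of
  \<open>t\<close>, so any parallel step from \<open>t\<close> can be completed to it. The diamond
  property follows at once.\<close>

lemma par_dev:
  "par t t' \<Longrightarrow> par t' (dev t)"
  "par_co l l' \<Longrightarrow> par_co l' (dev_co l)"
proof (induction rule: par_par_co.inducts)
  case (app t t' u u' l l')
  show ?case
  proof (cases t)
    case (Lam s)
    with app show ?thesis by (cases l) (auto intro: par_par_co.intros)
  qed (use app in \<open>auto intro: par_par_co.intros\<close>)
qed (auto intro: par_par_co.intros par_subst)


section \<open>Simulation on normal forms\<close>

text \<open>A head \<open>Var 0\<close> is never contracted and \<open>par_liftD\<close> preserves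
  vacuity, so a \<mu>-redex reduces to a \<mu>-redex and the step can be replayed below
  \<open>CoCons\<close>.\<close>

lemma par_msel:
  assumes "par v w"
  obtains l where "par_co (msel v) l" "nf_co l = msel (nf w)"
proof (cases v rule: msel_cases)
  case (1 u l)
  with assms obtain u' l' where "w = App (Var 0) u' l'" "par (lift 0 u) u'" "par_co (lift_co 0 l) l'"
    by (auto elim: par_App_Var)
  then obtain u'' l'' where "w = App (Var 0) (lift 0 u'') (lift_co 0 l'')" "par u u''" "par_co l l''"
    by (metis par_liftD)
  then show ?thesis using 1 that[of "CoCons u'' l''"] by (auto simp: nf_lift intro: par_par_co.intros)
next
  case 2
  then show ?thesis using assms that[of "Sel w"] by (auto intro: par_par_co.intros)
qed

text \<open>Resolves the overlap of \<beta>1 with \<mu>: after the \<mu>-contraction \<beta>2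
  applies instead, and it yields literally the same term, since substituting into the \<mu>-redex
  replaces its head and undoes the lifting.\<close>

lemma par_beta_msel:
  assumes "par t t'" "par u u'" "par v w"
  shows "par (App (Lam t) u (msel v)) (subst (subst u' 0 t') 0 w)"
proof (cases v rule: msel_cases)
  case (1 a l)
  with assms(3) obtain b m where "w = App (Var 0) b m" "par (lift 0 a) b" "par_co (lift_co 0 l) m"
    by (auto elim: par_App_Var)
  then obtain a' l' where "w = App (Var 0) (lift 0 a') (lift_co 0 l')" "par a a'" "par_co l l'"
    by (metis par_liftD)
  then show ?thesis using 1 assms by (auto intro: par_par_co.intros)
next
  case 2
  then show ?thesis using assms by (auto intro: par_par_co.intros)
qed

text \<open>Pushing an argument inwards preserves the \<beta>-redexes already present. The results
  agree only up to normal form, because the reduct may contain new \<pi>- and \<mu>-redexes.\<close>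

lemma par_papp:
  "par t t' \<Longrightarrow> par u u' \<Longrightarrow> par_co l l' \<Longrightarrow>
    \<exists>w. par (papp t u l) w \<and> nf w = papp (nf t') (nf u') (nf_co l')"
  "par_co m m' \<Longrightarrow> par u u' \<Longrightarrow> par_co l l' \<Longrightarrow>
    \<exists>w. par_co (papp_co m u l) w \<and> nf_co w = papp_co (nf_co m') (nf u') (nf_co l')"
proof (induction arbitrary: u u' l l' and u u' l l' rule: par_par_co.inducts)
  case (var i)
  then show ?case by (intro exI[of _ "App (Var i) u' l'"]) (auto intro: par_par_co.intros)
next
  case (lam t t')
  then show ?case by (intro exI[of _ "App (Lam t') u' l'"]) (auto intro: par_par_co.intros)
next
  case (app t t' u0 u0' l0 l0')
  from app.IH(3)[OF app.prems] obtain w where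
    "par_co (papp_co l0 u l) w" "nf_co w = papp_co (nf_co l0') (nf u') (nf_co l')" by blast
  with app.hyps show ?case
    by (intro exI[of _ "App t' u0' w"]) (auto simp: papp_assoc intro: par_par_co.app)
next
  case (beta1 t t' u0 u0' v v')
  from beta1.IH(3)[OF par_lift(1)[OF beta1.prems(1)] par_lift(2)[OF beta1.prems(2)]] obtain w where
    w: "par (papp v (lift 0 u) (lift_co 0 l)) w"
      "nf w = papp (nf v') (nf (lift 0 u')) (nf_co (lift_co 0 l'))"
    by blast
  let ?s = "subst u0' 0 t'"
  \<comment> \<open>Only the normal form of \<open>w\<close> is known, so \<open>w\<close> is
    exchanged under the substitution by \<open>nf_subst_nf\<close>.\<close>
  have "nf (subst ?s 0 w) = nf (subst ?s 0 (papp (nf v') (nf (lift 0 u')) (nf_co (lift_co 0 l'))))"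
    by (metis nf_subst_nf(1) w(2))
  \<comment> \<open>The pushed argument was lifted past the binder, so the substitution leaves it
    intact and only lowers it again.\<close>
  also have "\<dots> = papp (nf (subst ?s 0 v')) (nf u') (nf_co l')"
    by (simp add: nf_subst_papp nf_subst_nf)
  \<comment> \<open>The co-term of the redex is now built by \<open>msel\<close>, so
    \<open>par_beta_msel\<close> takes the place of \<open>beta1\<close>.\<close>
  finally show ?case
    using par_beta_msel[OF beta1.hyps(1,2) w(1)] by auto
next
  case (beta2 t t' u0 u0' v v' l0 l0')
  from beta2.IH(4)[OF beta2.prems] obtain w where
    "par_co (papp_co l0 u l) w" "nf_co w = papp_co (nf_co l0') (nf u') (nf_co l')" by blast
  with beta2.hyps show ?case
    by (intro exI[of _ "App (subst u0' 0 t') v' w"]) (auto simp: papp_assoc intro: par_par_co.beta2)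
next
  case (cons u0 u0' l0 l0')
  from cons.IH(2)[OF cons.prems] obtain w where
    "par_co (papp_co l0 u l) w" "nf_co w = papp_co (nf_co l0') (nf u') (nf_co l')" by blast
  with cons.hyps show ?case
    by (intro exI[of _ "CoCons u0' w"]) (auto intro: par_par_co.cons)
next
  case (sel v v')
  then obtain w where
    w: "par (papp v (lift 0 u) (lift_co 0 l)) w"
      "nf w = papp (nf v') (nf (lift 0 u')) (nf_co (lift_co 0 l'))"
    by (metis par_lift)
  from par_msel[OF w(1)] show ?case
    by (metis w(2) papp_co.simps(2) nf_co.simps(2) papp_co_msel nf_lift)
qed

text \<open>Normalising keeps a \<beta>-redex a \<beta>-redex, as its head stays an abstraction;
  \<open>msel\<close> can at most turn \<beta>1 into \<beta>2. Applications outside redexes are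
  handled by \<open>par_papp\<close>.\<close>

lemma par_nf:
  "par t t' \<Longrightarrow> \<exists>w. par (nf t) w \<and> nf w = nf t'"
  "par_co l l' \<Longrightarrow> \<exists>w. par_co (nf_co l) w \<and> nf_co w = nf_co l'"
proof (induction rule: par_par_co.inducts)
  case (var i)
  then show ?case by (intro exI[of _ "Var i"]) simp
next
  case (lam t t')
  then show ?case by (metis nf.simps(2) par_par_co.lam)
next
  case (app t t' u u' l l')
  then show ?case by (metis nf.simps(3) par_papp(1))
next
  case (beta1 t t' u u' v v')
  then obtain t1 u1 v1 where
    "par (nf t) t1" "nf t1 = nf t'" "par (nf u) u1" "nf u1 = nf u'" "par (nf v) v1" "nf v1 = nf v'"
    by blast
  then have "par (nf (App (Lam t) u (Sel v))) (subst (subst u1 0 t1) 0 v1)"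
    and "nf (subst (subst u1 0 t1) 0 v1) = nf (subst (subst u' 0 t') 0 v')"
    by (auto intro: par_beta_msel nf_subst_cong)
  then show ?case by blast
next
  case (beta2 t t' u u' v v' l l')
  then obtain t1 u1 v1 l1 where
    "par (nf t) t1" "nf t1 = nf t'" "par (nf u) u1" "nf u1 = nf u'" "par (nf v) v1" "nf v1 = nf v'"
    "par_co (nf_co l) l1" "nf_co l1 = nf_co l'"
    by blast
  then have "par (nf (App (Lam t) u (CoCons v l))) (App (subst u1 0 t1) v1 l1)"
    and "nf (App (subst u1 0 t1) v1 l1) = nf (App (subst u' 0 t') v' l')"
    using nf_subst_cong[of u1 u' t1 t' 0] by (simp_all add: par_par_co.beta2)
  then show ?case by blast
next
  case (cons u u' l l')
  then show ?case by (metis nf_co.simps(1) par_par_co.cons)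
next
  case (sel v v')
  then show ?case by (metis nf_co.simps(2) par_msel)
qed

section \<open>The composite step and its diamond property\<close>

definition nstep :: "trm \<Rightarrow> trm \<Rightarrow> bool" where
  "nstep t t' \<longleftrightarrow> (\<exists>w. par t w \<and> t' = nf w)"

definition nstep_co :: "cotrm \<Rightarrow> cotrm \<Rightarrow> bool" where
  "nstep_co l l' \<longleftrightarrow> (\<exists>w. par_co l w \<and> l' = nf_co w)"

lemma confluentp_diamond:
  assumes "\<And>x y z. r x y \<Longrightarrow> r x z \<Longrightarrow> \<exists>w. r y w \<and> r z w"
  shows "confluentp r"
  by (intro semiconfluentp_imp_confluentp strong_confluentp_into_semiconfluentp strong_confluentpI)
    (meson assms r_into_rtranclp sup2I1)

text \<open>Two steps from \<open>x\<close> meet at the normal form of \<open>dev x\<close>: the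
  triangle property closes the parallel steps, and \<open>par_nf\<close> carries the closing steps
  over to normal forms.\<close>

lemma confluentp_nstep: "confluentp nstep" "confluentp nstep_co"
proof -
  show "confluentp nstep"
    by (rule confluentp_diamond) (metis nstep_def par_dev(1) par_nf(1))
  show "confluentp nstep_co"
    by (rule confluentp_diamond) (metis nstep_co_def par_dev(2) par_nf(2))
qed


section \<open>Reduction\<close>

lemma red_nstep:
  "red t t' \<Longrightarrow> nstep (nf t) (nf t')"
  "red_co l l' \<Longrightarrow> nstep_co (nf_co l) (nf_co l')"
proof -
  \<comment> \<open>Root \<beta>-steps give the first alternative, root \<pi>- and \<mu>-steps the
    second, and each alternative is closed under all constructors.\<close>
  have "red t t' \<Longrightarrow> par t t' \<or> nf t = nf t'"
    and "red_co l l' \<Longrightarrow> par_co l l' \<or> nf_co l = nf_co l'"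
    unfolding red_def red_co_def
    by (induction rule: compat_compat_co.inducts)
      (auto simp: root_beta_def root_beta1.simps root_beta2.simps root_pi.simps root_mu.simps
        nf_co_append papp_assoc nf_lift intro: par_par_co.intros)
  \<comment> \<open>In the second alternative the composite step is the reflexive one, by
    idempotence of \<open>nf\<close>.\<close>
  then show "red t t' \<Longrightarrow> nstep (nf t) (nf t')" "red_co l l' \<Longrightarrow> nstep_co (nf_co l) (nf_co l')"
    unfolding nstep_def nstep_co_def by (metis par_nf par_refl nf_nf)+
qed

section \<open>Composite steps as reductions\<close>

lemma rtranclp_image:
  "r\<^sup>*\<^sup>* x y \<Longrightarrow> (\<And>x y. r x y \<Longrightarrow> q (f x) (f y)) \<Longrightarrow> q\<^sup>*\<^sup>* (f x) (f y)"
  by (induction rule: rtranclp_induct) (auto intro: rtranclp.rtrancl_into_rtrancl)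

lemma reds_cong:
  "red\<^sup>*\<^sup>* t t' \<Longrightarrow> red\<^sup>*\<^sup>* (Lam t) (Lam t')"
  "red\<^sup>*\<^sup>* t t' \<Longrightarrow> red\<^sup>*\<^sup>* u u' \<Longrightarrow> red_co\<^sup>*\<^sup>* l l' \<Longrightarrow> red\<^sup>*\<^sup>* (App t u l) (App t' u' l')"
  "red\<^sup>*\<^sup>* u u' \<Longrightarrow> red_co\<^sup>*\<^sup>* l l' \<Longrightarrow> red_co\<^sup>*\<^sup>* (CoCons u l) (CoCons u' l')"
  "red\<^sup>*\<^sup>* t t' \<Longrightarrow> red_co\<^sup>*\<^sup>* (Sel t) (Sel t')"
proof -
  show "red\<^sup>*\<^sup>* t t' \<Longrightarrow> red\<^sup>*\<^sup>* (Lam t) (Lam t')"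
    by (erule rtranclp_image) (simp add: red_def compat_compat_co.lam)
  show "red\<^sup>*\<^sup>* t t' \<Longrightarrow> red_co\<^sup>*\<^sup>* (Sel t) (Sel t')"
    by (erule rtranclp_image) (simp add: red_def red_co_def compat_compat_co.sel)
  show "red_co\<^sup>*\<^sup>* (CoCons u l) (CoCons u' l')" if "red\<^sup>*\<^sup>* u u'" "red_co\<^sup>*\<^sup>* l l'"
  proof -
    have "red_co\<^sup>*\<^sup>* (CoCons u l) (CoCons u' l)"
      using that(1) by (rule rtranclp_image) (simp add: red_def red_co_def cons_head)
    also have "red_co\<^sup>*\<^sup>* \<dots> (CoCons u' l')"
      using that(2) by (rule rtranclp_image) (simp add: red_def red_co_def cons_tail)
    finally show ?thesis .
  qed
  show "red\<^sup>*\<^sup>* (App t u l) (App t' u' l')" if "red\<^sup>*\<^sup>* t t'" "red\<^sup>*\<^sup>* u u'" "red_co\<^sup>*\<^sup>* l l'"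
  proof -
    have "red\<^sup>*\<^sup>* (App t u l) (App t' u l)"
      using that(1) by (rule rtranclp_image[of _ _ _ _ "\<lambda>t. App t u l"]) (simp add: red_def app_fun)
    also have "red\<^sup>*\<^sup>* \<dots> (App t' u' l)"
      using that(2) by (rule rtranclp_image[of _ _ _ _ "\<lambda>u. App t' u l"]) (simp add: red_def app_arg)
    also have "red\<^sup>*\<^sup>* \<dots> (App t' u' l')"
      using that(3) by (rule rtranclp_image) (simp add: red_def red_co_def app_co)
    finally show ?thesis .
  qed
qed

lemma red_root:
  "red (App (Lam t) u (Sel v)) (subst (subst u 0 t) 0 v)"
  "red (App (Lam t) u (CoCons v l)) (App (subst u 0 t) v l)"
  "red (App (App t u l) u' l') (App t u (co_append l u' l'))"
  "red_co (Sel (App (Var 0) (lift 0 u) (lift_co 0 l))) (CoCons u l)"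
  by (auto simp: red_def red_co_def root_beta_def
      intro!: base base_co root_beta1.intros root_beta2.intros root_pi.intros root_mu.intros)

lemma reds_par:
  "par t t' \<Longrightarrow> red\<^sup>*\<^sup>* t t'"
  "par_co l l' \<Longrightarrow> red_co\<^sup>*\<^sup>* l l'"
proof (induction rule: par_par_co.inducts)
  case (beta1 t t' u u' v v')
  then have "red\<^sup>*\<^sup>* (App (Lam t) u (Sel v)) (App (Lam t') u' (Sel v'))"
    by (intro reds_cong)
  then show ?case using red_root(1) by (rule rtranclp.rtrancl_into_rtrancl)
next
  case (beta2 t t' u u' v v' l l')
  then have "red\<^sup>*\<^sup>* (App (Lam t) u (CoCons v l)) (App (Lam t') u' (CoCons v' l'))"
    by (intro reds_cong)
  then show ?case using red_root(2) by (rule rtranclp.rtrancl_into_rtrancl)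
qed (auto intro: reds_cong)

lemma reds_msel: "red_co\<^sup>*\<^sup>* (Sel v) (msel v)"
  by (cases v rule: msel_cases) (auto intro: red_root)

text \<open>\<open>co_append\<close> looks below \<open>Sel\<close> at the shape of the term, two
  constructors deep. The second conjunct supplies the case of \<open>Sel t\<close> together with
  \<open>t\<close>, so that structural induction suffices.\<close>

lemma reds_papp:
  "red\<^sup>*\<^sup>* (App t u' l') (papp t u' l')
    \<and> red_co\<^sup>*\<^sup>* (co_append (Sel t) u' l') (papp_co (Sel t) u' l')"
  "red_co\<^sup>*\<^sup>* (co_append l u' l') (papp_co l u' l')"
proof (induction t and l arbitrary: u' l' and u' l' rule: trm.induct cotrm.induct)
  case (App t u l)
  \<comment> \<open>Stated for all arguments, as both the lifted and the original ones are
    needed.\<close>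
  have *: "red\<^sup>*\<^sup>* (App t u (co_append l u' l')) (App t u (papp_co l u' l'))" for u' l'
    by (intro reds_cong App rtranclp.rtrancl_refl)
  then have "red_co\<^sup>*\<^sup>* (co_append (Sel (App t u l)) u' l') (Sel (papp (App t u l) (lift 0 u') (lift_co 0 l')))"
    by (simp add: reds_cong)
  then have "red_co\<^sup>*\<^sup>* (co_append (Sel (App t u l)) u' l') (papp_co (Sel (App t u l)) u' l')"
    using reds_msel by (metis papp_co.simps(2) rtranclp_trans)
  moreover have "red\<^sup>*\<^sup>* (App (App t u l) u' l') (papp (App t u l) u' l')"
    using * red_root(3) by (metis converse_rtranclp_into_rtranclp papp.simps(3))
  ultimately show ?case by simp
qed (auto intro: reds_cong reds_msel)

lemma reds_nf:
  "red\<^sup>*\<^sup>* t (nf t)"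
  "red_co\<^sup>*\<^sup>* l (nf_co l)"
proof (induction t and l rule: trm.induct cotrm.induct)
  case (App t u l)
  then have "red\<^sup>*\<^sup>* (App t u l) (App (nf t) (nf u) (nf_co l))"
    by (intro reds_cong)
  then show ?case using reds_papp(1) by (metis nf.simps(3) rtranclp_trans)
next
  case (Sel v)
  then have "red_co\<^sup>*\<^sup>* (Sel v) (Sel (nf v))" by (intro reds_cong)
  then show ?case using reds_msel by (metis nf_co.simps(2) rtranclp_trans)
qed (auto intro: reds_cong)

lemma reds_nstep:
  "nstep\<^sup>*\<^sup>* t t' \<Longrightarrow> red\<^sup>*\<^sup>* t t'"
  "nstep_co\<^sup>*\<^sup>* l l' \<Longrightarrow> red_co\<^sup>*\<^sup>* l l'"
proof -
  show "nstep\<^sup>*\<^sup>* t t' \<Longrightarrow> red\<^sup>*\<^sup>* t t'"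
    by (induction rule: rtranclp_induct) (auto simp: nstep_def, meson reds_par reds_nf rtranclp_trans)
  show "nstep_co\<^sup>*\<^sup>* l l' \<Longrightarrow> red_co\<^sup>*\<^sup>* l l'"
    by (induction rule: rtranclp_induct) (auto simp: nstep_co_def, meson reds_par reds_nf rtranclp_trans)
qed

text \<open>Interpretation method: a peak of \<open>r\<close> is mapped by \<open>f\<close> to a
  peak of \<open>s\<close>, closed there, and read back as \<open>r\<close>-reductions preceded by
  those from \<open>y\<close> to \<open>f y\<close> and from \<open>z\<close> to
  \<open>f z\<close>.\<close>

lemma confluentp_by_normalisation:
  assumes "confluentp s"
    and "\<And>x y. r x y \<Longrightarrow> s (f x) (f y)"
    and "\<And>x y. s\<^sup>*\<^sup>* x y \<Longrightarrow> r\<^sup>*\<^sup>* x y"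
    and "\<And>x. r\<^sup>*\<^sup>* x (f x)"
  shows "confluentp r"
proof -
  have "\<exists>w. r\<^sup>*\<^sup>* y w \<and> r\<^sup>*\<^sup>* z w" if xy: "r\<^sup>*\<^sup>* x y" and xz: "r\<^sup>*\<^sup>* x z" for x y z
  proof -
    have "s\<^sup>*\<^sup>* (f x) (f y)" "s\<^sup>*\<^sup>* (f x) (f z)"
      using xy xz by (auto intro: rtranclp_image[where f = f] assms(2))
    then obtain w where "s\<^sup>*\<^sup>* (f y) w" "s\<^sup>*\<^sup>* (f z) w"
      using confluentpD[OF assms(1)] by blast
    then show ?thesis by (meson assms(3,4) rtranclp_trans)
  qed
  then show ?thesis by (rule confluentpI)
qed

theorem theorem3p3:
  shows "confluentp red \<and> confluentp red_co"
  using confluentp_by_normalisation[OF confluentp_nstep(1) red_nstep(1) reds_nstep(1) reds_nf(1)]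
    confluentp_by_normalisation[OF confluentp_nstep(2) red_nstep(2) reds_nstep(2) reds_nf(2)]
  by blast

end
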